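(* For all positive integers $m,n$, $$\operatorname{cdeg}(\mathbb{Z}_m\times\mathbb{Z}_n)=\frac{\displaystyle\sum_{a\mid m,\ b\mid n}\varphi(\gcd(a,b))}{\displaystyle\sum_{a\mid m,\ b\mid n}\gcd(a,b)},$$ where in both sums $a$ runs over the positive divisors of $m$ and $b$ over the positive divisors of $n$.
   Context: For a finite group $G$, let $L(G)$ be the set of all subgroups of $G$ and $C(G)$ the set of all cyclic subgroups of $G$. The cyclicity degree of $G$ is $\operatorname{cdeg}(G)=|C(G)|/|L(G)|$. $\mathbb{Z}_n$ denotes the cyclic group of order $n$ and $\varphi$ is Euler's totient function. *)

theory Defs
  imports "HOL-Algebra.Elementary_Groups" "HOL-Number_Theory.Totient"
begin

definition subgroups_of :: "('a, 'b) monoid_scheme \<Rightarrow> 'a set set" where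
  "subgroups_of G = {H. subgroup H G}"

definition cyclic_subgroups_of :: "('a, 'b) monoid_scheme \<Rightarrow> 'a set set" where
  "cyclic_subgroups_of G = {H. subgroup H G \<and> cyclic_group (G\<lparr>carrier := H\<rparr>)}"

(* Meaningful for finite groups only: card is 0 on infinite sets. *)
definition cdeg :: "('a, 'b) monoid_scheme \<Rightarrow> real" where
  "cdeg G = real (card (cyclic_subgroups_of G)) / real (card (subgroups_of G))"

end

theory Submission
  imports Defs "HOL-Algebra.Multiplicative_Group" "HOL-Library.Product_Plus"
begin

text \<open>
  A cyclic subgroup of order \<open>k\<close> has \<open>\<phi>(k)\<close> generators, so the number of cyclic subgroups is the
  sum of \<open>1 / \<phi>(ord g)\<close> over all group elements \<open>g\<close>. In the product there are \<open>\<phi>(a) \<phi>(b)\<close> elements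
  whose components have orders \<open>a\<close> and \<open>b\<close>, each of order \<open>lcm a b\<close>, and
  \<open>\<phi>(a) \<phi>(b) = \<phi>(gcd a b) \<phi>(lcm a b)\<close>.

  Subgroups of the product are the lattices between \<open>m\<int> \<times> n\<int>\<close> and \<open>\<int> \<times> \<int>\<close>. Each has a unique
  Hermite normal form with rows \<open>(d, t)\<close> and \<open>(0, b)\<close>, where \<open>d\<close> divides \<open>m\<close>, \<open>b\<close> divides \<open>n\<close>,
  \<open>t < b\<close> and \<open>b\<close> divides \<open>(m / d) t\<close>; given \<open>d\<close> and \<open>b\<close>, there are \<open>gcd (m / d) b\<close> choices of \<open>t\<close>.
\<close>

subsection \<open>Cyclic subgroups\<close>

context group
begin

text \<open>The exponents run over 1, ..., \<open>ord x\<close> instead of starting at 0, to match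
  the interval on which \<open>card_gcd_eq_totient\<close> counts.\<close>

lemma generate_singleton_eq_image:
  assumes "finite (carrier G)" "x \<in> carrier G"
  shows "generate G {x} = (\<lambda>k. x [^] k) ` {0<..ord x}"
proof (intro equalityI subsetI)
  fix y assume "y \<in> generate G {x}"
  then obtain k :: nat where k: "y = x [^] k"
    using generate_pow_on_finite_carrier[OF assms] by auto
  have pos: "ord x > 0"
    using ord_ge_1[OF assms] by simp
  show "y \<in> (\<lambda>k. x [^] k) ` {0<..ord x}"
  proof (cases "ord x dvd k")
    \<comment> \<open>Exponent 0 lies outside the interval; \<open>ord x\<close> takes its
      place.\<close>
    case True
    then have "y = x [^] ord x"
      using k assms by (simp add: pow_eq_id[THEN iffD2])
    then show ?thesis using pos by auto
  next
    case False
    have "y = x [^] (ord x * (k div ord x) + k mod ord x)"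
      using k by simp
    also have "\<dots> = x [^] (k mod ord x)"
      using assms by (simp only: nat_pow_mult[symmetric] nat_pow_pow[symmetric]) simp
    finally have "y = x [^] (k mod ord x)" .
    moreover have "k mod ord x \<in> {0<..ord x}"
      using False pos by (auto simp: dvd_eq_mod_eq_0 intro: less_imp_le)
    ultimately show ?thesis by blast
  qed
next
  fix y assume "y \<in> (\<lambda>k. x [^] k) ` {0<..ord x}"
  then show "y \<in> generate G {x}"
    using generate_pow_on_finite_carrier[OF assms] by auto
qed

text \<open>With \<open>n = ord x\<close>, the power \<open>x [^] k\<close> has order
  \<open>n div gcd k n\<close>, so elements of order \<open>d\<close> correspond to exponents
  \<open>k\<close> with \<open>gcd k n = n div d\<close>. The lemma serves twice:
  \<open>d = ord x\<close> counts generators, and a generator \<open>x\<close> of Z_n gives the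
  distribution of orders in Z_n.\<close>

lemma card_elements_of_ord_in_generate:
  assumes fin: "finite (carrier G)" and x: "x \<in> carrier G" and d: "d dvd ord x"
  shows "card {y \<in> generate G {x}. ord y = d} = totient d"
proof -
  define n where "n = ord x"
  have pos: "n > 0"
    using ord_ge_1[OF fin x] by (simp add: n_def)
  obtain e where e: "n = d * e" using d by (auto simp: n_def)
  have [simp]: "d > 0" "e > 0" using pos e by auto
  have *: "ord (x [^] k) = d \<longleftrightarrow> gcd k n = n div d" if "k \<in> {0<..n}" for k
  proof -
    obtain g where g: "n = gcd k n * g" by (meson dvdE gcd_dvd2)
    have gp: "gcd k n > 0" using that by simp
    have "ord (x [^] k) = n div gcd k n"
      using that by (simp add: ord_pow_gen[OF x] n_def gcd.commute)
    also have "\<dots> = g" using g gp by (metis nonzero_mult_div_cancel_left less_numeral_extra(3))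
    finally have "ord (x [^] k) = g" .
    moreover have "n div d = e" using e by simp
    \<comment> \<open>Both \<open>gcd k n * g\<close> and \<open>d * e\<close> equal
      \<open>n\<close>, so equality of one factor forces equality of the other.\<close>
    moreover have "g = d \<longleftrightarrow> gcd k n = e"
      using g e gp pos by (metis mult.commute mult_cancel_right nat_neq_iff \<open>d > 0\<close> \<open>e > 0\<close>)
    ultimately show ?thesis by simp
  qed
  have "{y \<in> generate G {x}. ord y = d} = (\<lambda>k. x [^] k) ` {k \<in> {0<..n}. gcd k n = n div d}"
    unfolding generate_singleton_eq_image[OF fin x] n_def[symmetric] using * by blast
  moreover have "inj_on (\<lambda>k. x [^] k) {k \<in> {0<..n}. gcd k n = n div d}"
    by (rule inj_on_subset[OF ord_inj'[OF x]]) (auto simp: n_def)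
  ultimately have "card {y \<in> generate G {x}. ord y = d} = card {k \<in> {0<..n}. gcd k n = n div d}"
    by (simp add: card_image)
  also have "\<dots> = totient (n div (n div d))"
    using pos e by (intro card_gcd_eq_totient) auto
  also have "n div (n div d) = d" using e by simp
  finally show ?thesis .
qed

text \<open>An element of the finite group generated by \<open>x\<close> generates all of it as soon
  as its order equals \<open>ord x\<close>, by comparing cardinalities.\<close>

lemma card_generators_of_generate:
  assumes fin: "finite (carrier G)" and x: "x \<in> carrier G"
  shows "card {y \<in> carrier G. generate G {y} = generate G {x}} = totient (ord x)"
proof -
  have "generate G {y} = generate G {x} \<longleftrightarrow> y \<in> generate G {x} \<and> ord y = ord x"
    if y: "y \<in> carrier G" for y
  proof
    assume "generate G {y} = generate G {x}"
    then show "y \<in> generate G {x} \<and> ord y = ord x"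
      using generate.incl[of y "{y}" G] generate_pow_card x y by auto
  next
    assume *: "y \<in> generate G {x} \<and> ord y = ord x"
    have "generate G {y} \<subseteq> generate G {x}"
      using * x by (intro generate_subgroup_incl generate_is_subgroup) auto
    moreover have "finite (generate G {x})"
      using fin x generate_incl[of "{x}"] finite_subset by blast
    ultimately show "generate G {y} = generate G {x}"
      using * generate_pow_card x y by (intro card_subset_eq) auto
  qed
  moreover have "generate G {x} \<subseteq> carrier G" using x generate_incl by simp
  ultimately have "{y \<in> carrier G. generate G {y} = generate G {x}} = {y \<in> generate G {x}. ord y = ord x}"
    by blast
  then show ?thesis
    using card_elements_of_ord_in_generate[OF fin x dvd_refl] by simp
qed

text \<open>Passes from cyclicity of \<open>H\<close> as a group in its own right to generation
  inside \<open>G\<close>; powers of an element of \<open>H\<close> agree in both groups.\<close>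

lemma cyclic_subgroups_of_eq: "cyclic_subgroups_of G = (\<lambda>x. generate G {x}) ` carrier G"
proof (intro equalityI subsetI)
  fix H assume "H \<in> cyclic_subgroups_of G"
  then have H: "subgroup H G" and cyc: "cyclic_group (G\<lparr>carrier := H\<rparr>)"
    by (auto simp: cyclic_subgroups_of_def)
  interpret H: group "G\<lparr>carrier := H\<rparr>"
    using H by (rule subgroup_imp_group)
  obtain x where x: "x \<in> H" "H = range (\<lambda>n::int. x [^]\<^bsub>G\<lparr>carrier := H\<rparr>\<^esub> n)"
    using cyc by (auto simp: H.cyclic_group)
  have "x [^]\<^bsub>G\<lparr>carrier := H\<rparr>\<^esub> n = x [^] n" for n :: int
    using int_pow_consistent[OF H x(1)] by simp
  then have "H = generate G {x}"
    using x H by (auto simp: generate_pow subgroup.mem_carrier)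
  then show "H \<in> (\<lambda>x. generate G {x}) ` carrier G"
    using x H subgroup.mem_carrier by fastforce
next
  fix H assume "H \<in> (\<lambda>x. generate G {x}) ` carrier G"
  then obtain x where x: "x \<in> carrier G" "H = generate G {x}" by blast
  then have "G\<lparr>carrier := H\<rparr> = subgroup_generated G {x}"
    by (simp add: subgroup_generated_def)
  then show "H \<in> cyclic_subgroups_of G"
    using x cyclic_group_generated[of x] generate_is_subgroup[of "{x}"]
    by (simp add: cyclic_subgroups_of_def)
qed

text \<open>The fibre of \<open>\<lambda>x. generate G {x}\<close> over a cyclic subgroup consists
  of its generators. They share one order, and their number cancels the common weight, so each fibre
  contributes 1.\<close>

lemma card_cyclic_subgroups_of:
  assumes fin: "finite (carrier G)"
  shows "real (card (cyclic_subgroups_of G)) = (\<Sum>x\<in>carrier G. 1 / real (totient (ord x)))"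
proof -
  let ?f = "\<lambda>x. generate G {x}"
  have "(\<Sum>x | x \<in> carrier G \<and> ?f x = H. 1 / real (totient (ord x))) = 1"
    if "H \<in> ?f ` carrier G" for H
  proof -
    obtain z where z: "z \<in> carrier G" "H = ?f z" using \<open>H \<in> _\<close> by blast
    have "(\<Sum>x | x \<in> carrier G \<and> ?f x = H. 1 / real (totient (ord x))) =
          (\<Sum>x | x \<in> carrier G \<and> ?f x = H. 1 / real (totient (ord z)))"
      using z generate_pow_card by (intro sum.cong) auto
    also have "\<dots> = 1"
      using card_generators_of_generate[OF fin z(1)] ord_ge_1[OF fin z(1)] z(2) by simp
    finally show ?thesis .
  qed
  then have "(\<Sum>x\<in>carrier G. 1 / real (totient (ord x))) = (\<Sum>H\<in>?f ` carrier G. 1)"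
    by (subst sum.image_gen[OF fin, of _ ?f]) simp
  then show ?thesis by (simp add: cyclic_subgroups_of_eq)
qed

end

section \<open>Element orders in Z_n and in products, and the count of cyclic subgroups\<close>

lemma nat_pow_DirProd:
  "(x, y) [^]\<^bsub>G \<times>\<times> H\<^esub> (k::nat) = (x [^]\<^bsub>G\<^esub> k, y [^]\<^bsub>H\<^esub> k)"
  by (induction k) simp_all

text \<open>A power of a pair is trivial iff its exponent is a common multiple of the orders of both
  components.\<close>

lemma ord_DirProd:
  assumes "group G" "group H" "x \<in> carrier G" "y \<in> carrier H"
  shows "group.ord (G \<times>\<times> H) (x, y) = lcm (group.ord G x) (group.ord H y)"
  using assms
  by (subst group.ord_unique[OF DirProd_group])
     (auto simp: nat_pow_DirProd group.pow_eq_id)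

lemma card_elements_of_ord_integer_mod_group:
  assumes "n > 0" "d dvd n"
  shows "card {x \<in> carrier (integer_mod_group n). group.ord (integer_mod_group n) x = d} = totient d"
proof -
  interpret Z: group "integer_mod_group n" by simp
  have fin: "finite (carrier (integer_mod_group n))"
    using assms by (simp add: carrier_integer_mod_group)
  \<comment> \<open>The reduction matters for \<open>n = 1\<close>, where the carrier is {0} and 1
    lies outside it.\<close>
  define u where "u = 1 mod int n"
  have u: "u \<in> carrier (integer_mod_group n)"
    using assms by (simp add: u_def carrier_integer_mod_group)
  have "generate (integer_mod_group n) {u} = carrier (integer_mod_group n)"
  proof
    show "generate (integer_mod_group n) {u} \<subseteq> carrier (integer_mod_group n)"
      using u by (intro Z.generate_incl) simp
    show "carrier (integer_mod_group n) \<subseteq> generate (integer_mod_group n) {u}"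
    proof
      fix x assume "x \<in> carrier (integer_mod_group n)"
      then have "x = u [^]\<^bsub>integer_mod_group n\<^esub> x"
        using assms by (simp add: int_pow_integer_mod_group u_def carrier_integer_mod_group mod_mult_right_eq)
      then show "x \<in> generate (integer_mod_group n) {u}"
        using Z.generate_pow[OF u] by blast
    qed
  qed
  moreover from this have "Z.ord u = n"
    using Z.generate_pow_card[OF u] assms by (simp add: carrier_integer_mod_group)
  ultimately show ?thesis
    using Z.card_elements_of_ord_in_generate[OF fin u, of d] assms by simp
qed

text \<open>Groups the elements by order. The weight \<open>f\<close> is arbitrary so that the two
  coordinates of a product can be treated one after the other.\<close>

lemma sum_ord_integer_mod_group:
  fixes f :: "nat \<Rightarrow> real"
  assumes "n > 0"
  shows "(\<Sum>x\<in>carrier (integer_mod_group n). f (group.ord (integer_mod_group n) x)) =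
         (\<Sum>d | d dvd n. real (totient d) * f d)"
proof -
  interpret Z: group "integer_mod_group n" by simp
  let ?C = "carrier (integer_mod_group n)"
  have fin: "finite ?C" and card: "card ?C = n"
    using assms by (simp_all add: carrier_integer_mod_group)
  have "(\<Sum>x\<in>?C. f (Z.ord x)) = (\<Sum>d | d dvd n. \<Sum>x | x \<in> ?C \<and> Z.ord x = d. f (Z.ord x))"
    using assms Z.ord_dvd_group_order fin card
    by (intro sum.group[symmetric]) (auto simp: order_def)
  also have "\<dots> = (\<Sum>d | d dvd n. real (totient d) * f d)"
    using card_elements_of_ord_integer_mod_group[OF assms] by (intro sum.cong) simp_all
  finally show ?thesis .
qed

lemma card_cyclic_subgroups_of_integer_mod_group_DirProd:
  assumes "m > 0" "n > 0"
  shows "card (cyclic_subgroups_of (integer_mod_group m \<times>\<times> integer_mod_group n)) =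
         (\<Sum>a | a dvd m. \<Sum>b | b dvd n. totient (gcd a b))"
proof -
  let ?M = "integer_mod_group m" and ?N = "integer_mod_group n"
  interpret G: group "?M \<times>\<times> ?N" by (simp add: DirProd_group)
  have fin: "finite (carrier (?M \<times>\<times> ?N))"
    using assms by (simp add: carrier_integer_mod_group)
  have *: "real (totient a) * (real (totient b) * (1 / real (totient (lcm a b)))) = real (totient (gcd a b))"
    if "a dvd m" "b dvd n" for a b
  proof -
    have "a \<noteq> 0" "b \<noteq> 0"
      using assms that by auto
    then show ?thesis
      using arg_cong[OF totient_gcd_lcm[of a b], of real] by (simp add: field_simps)
  qed
  have "real (card (cyclic_subgroups_of (?M \<times>\<times> ?N))) =
        (\<Sum>x\<in>carrier ?M. \<Sum>y\<in>carrier ?N. 1 / real (totient (lcm (group.ord ?M x) (group.ord ?N y))))"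
    by (subst G.card_cyclic_subgroups_of[OF fin])
       (auto simp: sum.cartesian_product ord_DirProd intro!: sum.cong)
  \<comment> \<open>With \<open>x\<close> fixed, the inner summand depends on \<open>y\<close> only
    through its order; afterwards the whole inner sum depends on \<open>x\<close> only through its
    order.\<close>
  also have "\<dots> = (\<Sum>x\<in>carrier ?M. \<Sum>b | b dvd n.
                   real (totient b) * (1 / real (totient (lcm (group.ord ?M x) b))))"
    by (intro sum.cong refl sum_ord_integer_mod_group assms)
  also have "\<dots> = (\<Sum>a | a dvd m. real (totient a) * (\<Sum>b | b dvd n.
                   real (totient b) * (1 / real (totient (lcm a b)))))"
    by (rule sum_ord_integer_mod_group) fact
  also have "\<dots> = (\<Sum>a | a dvd m. \<Sum>b | b dvd n. real (totient (gcd a b)))"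
    using * by (simp only: sum_distrib_left) (auto intro!: sum.cong simp: mult_ac)
  also have "\<dots> = real (\<Sum>a | a dvd m. \<Sum>b | b dvd n. totient (gcd a b))"
    by simp
  finally show ?thesis by (simp only: of_nat_eq_iff)
qed

subsection \<open>Subgroups as lattices\<close>

text \<open>These are the full preimages in \<open>int \<times> int\<close> of the subgroups of Z_m
  x Z_n. Closure under differences suffices for a subgroup because \<open>(int m, 0)\<close> makes
  \<open>S\<close> nonempty.\<close>

definition period_lattices :: "nat \<Rightarrow> nat \<Rightarrow> (int \<times> int) set set" where
  "period_lattices m n =
     {S. (\<forall>u\<in>S. \<forall>v\<in>S. u - v \<in> S) \<and> (int m, 0) \<in> S \<and> (0, int n) \<in> S}"

text \<open>Differences yield zero as \<open>u - u\<close>, sums as \<open>u - (0 - v)\<close>, and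
  multiples by induction on \<open>k\<close> in both directions.\<close>

lemma period_lattices_closed:
  assumes "S \<in> period_lattices m n"
  shows period_lattices_zero: "(0, 0) \<in> S"
    and period_lattices_diff: "\<And>x y x' y'. (x, y) \<in> S \<Longrightarrow> (x', y') \<in> S \<Longrightarrow> (x - x', y - y') \<in> S"
    and period_lattices_add: "\<And>x y x' y'. (x, y) \<in> S \<Longrightarrow> (x', y') \<in> S \<Longrightarrow> (x + x', y + y') \<in> S"
    and period_lattices_mult: "\<And>x y k. (x, y) \<in> S \<Longrightarrow> (k * x, k * y) \<in> S"
proof -
  show diff: "(x - x', y - y') \<in> S" if "(x, y) \<in> S" "(x', y') \<in> S" for x y x' y'
    using assms that by (force simp: period_lattices_def)
  show zero: "(0, 0) \<in> S"
    using diff[of "int m" 0 "int m" 0] assms by (simp add: period_lattices_def)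
  show add: "(x + x', y + y') \<in> S" if "(x, y) \<in> S" "(x', y') \<in> S" for x y x' y'
    using diff[OF that(1) diff[OF zero that(2)]] by simp
  show "(k * x, k * y) \<in> S" if "(x, y) \<in> S" for x y k
  proof (induction k rule: int_induct[where k = 0])
    case base
    show ?case using zero by simp
  next
    case (step1 i)
    then show ?case using add[OF step1(2) that] by (simp add: algebra_simps)
  next
    case (step2 i)
    then show ?case using diff[OF step2(2) that] by (simp add: algebra_simps)
  qed
qed

text \<open>The two points differ by a combination of \<open>(int m, 0)\<close> and
  \<open>(0, int n)\<close>, which lies in \<open>S\<close>.\<close>

lemma period_lattices_mod_iff:
  assumes "S \<in> period_lattices m n"
  shows "(x mod int m, y mod int n) \<in> S \<longleftrightarrow> (x, y) \<in> S"
proof -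
  have "(int m, 0) \<in> S" "(0, int n) \<in> S"
    using assms by (auto simp: period_lattices_def)
  from period_lattices_add[OF assms period_lattices_mult[OF assms this(1)] period_lattices_mult[OF assms this(2)]]
  have *: "(x div int m * int m, y div int n * int n) \<in> S"
    by simp
  show ?thesis
    using period_lattices_add[OF assms _ *, of "x mod int m" "y mod int n"]
      period_lattices_diff[OF assms _ *, of x y]
    by (auto simp: minus_div_mult_eq_mod)
qed

text \<open>This is the correspondence theorem for the quotient of Z x Z by mZ x nZ. Group elements
  are pairs of least residues and \<open>S\<close> is stable under reduction, so the image of
  \<open>S\<close> in the quotient is its intersection with the carrier. The inverse takes the
  preimage under reduction.\<close>

lemma bij_betw_period_lattices_subgroups_of:
  assumes "m > 0" "n > 0"
  shows "bij_betw (\<lambda>S. S \<inter> carrier (integer_mod_group m \<times>\<times> integer_mod_group n))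
           (period_lattices m n) (subgroups_of (integer_mod_group m \<times>\<times> integer_mod_group n))"
proof -
  let ?G = "integer_mod_group m \<times>\<times> integer_mod_group n"
  interpret G: group ?G by (simp add: DirProd_group)
  have carrier: "carrier (integer_mod_group m) = {0..<int m}" "carrier (integer_mod_group n) = {0..<int n}"
    using assms by (simp_all add: carrier_integer_mod_group)
  have inv: "inv\<^bsub>?G\<^esub> (x, y) = (- x mod int m, - y mod int n)"
    if "(x, y) \<in> carrier ?G" for x y
    using that by simp
  show ?thesis
  proof (rule bij_betw_byWitness[where f' = "\<lambda>H. {(x, y). (x mod int m, y mod int n) \<in> H}"])
    show "\<forall>S\<in>period_lattices m n. {(x, y). (x mod int m, y mod int n) \<in> S \<inter> carrier ?G} = S"
      using assms by (auto simp: period_lattices_mod_iff carrier)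
    have "{(x, y). (x mod int m, y mod int n) \<in> H} \<inter> carrier ?G = H" if "subgroup H ?G" for H
    proof -
      have "H \<subseteq> {0..<int m} \<times> {0..<int n}"
        using subgroup.subset[OF that] carrier by simp
      then show ?thesis
        by (auto simp: carrier)
    qed
    then show "\<forall>H\<in>subgroups_of ?G. {(x, y). (x mod int m, y mod int n) \<in> H} \<inter> carrier ?G = H"
      by (simp add: subgroups_of_def)
    show "(\<lambda>S. S \<inter> carrier ?G) ` period_lattices m n \<subseteq> subgroups_of ?G"
    proof safe
      fix S assume S: "S \<in> period_lattices m n"
      have "subgroup (S \<inter> carrier ?G) ?G"
      proof (rule G.subgroupI)
        show "S \<inter> carrier ?G \<noteq> {}"
          using period_lattices_zero[OF S] assms by (auto simp: carrier)
        show "inv\<^bsub>?G\<^esub> u \<in> S \<inter> carrier ?G" if u: "u \<in> S \<inter> carrier ?G" for u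
        proof (cases u)
          case (Pair x y)
          then show ?thesis
            using u period_lattices_diff[OF S period_lattices_zero[OF S], of x y] assms
            by (simp add: inv carrier period_lattices_mod_iff[OF S] del: inv_DirProd)
        qed
        show "u \<otimes>\<^bsub>?G\<^esub> v \<in> S \<inter> carrier ?G"
          if "u \<in> S \<inter> carrier ?G" "v \<in> S \<inter> carrier ?G" for u v
          using that period_lattices_add[OF S, of "fst u" "snd u" "fst v" "snd v"] assms
          by (auto simp: carrier mult_DirProd' period_lattices_mod_iff[OF S])
      qed auto
      then show "S \<inter> carrier ?G \<in> subgroups_of ?G"
        by (simp add: subgroups_of_def)
    qed
    show "(\<lambda>H. {(x, y). (x mod int m, y mod int n) \<in> H}) ` subgroups_of ?G \<subseteq> period_lattices m n"
    proof safe
      fix H assume "H \<in> subgroups_of ?G"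
      then have H: "subgroup H ?G" by (simp add: subgroups_of_def)
      have zero: "(0, 0) \<in> H"
        using subgroup.one_closed[OF H] by simp
      have "((x - x') mod int m, (y - y') mod int n) \<in> H"
        if "(x mod int m, y mod int n) \<in> H" "(x' mod int m, y' mod int n) \<in> H" for x y x' y'
      proof -
        have "(x mod int m, y mod int n) \<otimes>\<^bsub>?G\<^esub> inv\<^bsub>?G\<^esub> (x' mod int m, y' mod int n) \<in> H"
          by (intro subgroup.m_closed[OF H] subgroup.m_inv_closed[OF H] that)
        moreover have "(x' mod int m, y' mod int n) \<in> carrier ?G"
          using that(2) subgroup.mem_carrier[OF H] by blast
        ultimately show ?thesis
          by (simp add: inv mod_simps del: inv_DirProd)
      qed
      then show "{(x, y). (x mod int m, y mod int n) \<in> H} \<in> period_lattices m n"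
        using zero by (auto simp: period_lattices_def)
    qed
  qed
qed

section \<open>Hermite normal forms of period lattices\<close>

text \<open>The integer row span of the matrix with rows \<open>(d, t)\<close> and
  \<open>(0, b)\<close>. In the triple \<open>b\<close> precedes \<open>t\<close> because the range
  of \<open>t\<close> in \<open>hermite_params\<close> depends on it.\<close>

definition hermite_lattice :: "nat \<times> nat \<times> nat \<Rightarrow> (int \<times> int) set" where
  "hermite_lattice = (\<lambda>(d, b, t). {(int d * i, int t * i + int b * j) | i j. True})"

text \<open>As \<open>d > 0\<close>, the first coordinate determines the coefficient of
  \<open>(d, t)\<close>; what remains must be a multiple of \<open>(0, b)\<close>.\<close>

lemma mem_hermite_lattice_iff:
  assumes "d > 0"
  shows "(int d * i, y) \<in> hermite_lattice (d, b, t) \<longleftrightarrow> int b dvd y - int t * i"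
proof
  assume "(int d * i, y) \<in> hermite_lattice (d, b, t)"
  then show "int b dvd y - int t * i"
    using assms by (auto simp: hermite_lattice_def)
next
  assume "int b dvd y - int t * i"
  then obtain j where "y - int t * i = int b * j" by auto
  then have "y = int t * i + int b * j" by simp
  then show "(int d * i, y) \<in> hermite_lattice (d, b, t)"
    by (auto simp: hermite_lattice_def)
qed

lemma fst_hermite_lattice: "fst ` hermite_lattice (d, b, t) = {x. int d dvd x}"
proof (intro equalityI subsetI)
  fix x assume "x \<in> {x. int d dvd x}"
  then obtain i where "x = int d * i" by auto
  then have "(x, int t * i + int b * 0) \<in> hermite_lattice (d, b, t)"
    unfolding hermite_lattice_def by blast
  then show "x \<in> fst ` hermite_lattice (d, b, t)" by force
qed (auto simp: hermite_lattice_def)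

text \<open>Take the least positive element \<open>d\<close>, which exists because of
  \<open>m\<close>. The remainder modulo \<open>d\<close> of an element of \<open>A\<close> lies in
  \<open>A\<close> and is below \<open>d\<close>, hence is 0.\<close>

lemma int_subgroup_eq_multiples:
  fixes A :: "int set"
  assumes diff: "\<And>x y. x \<in> A \<Longrightarrow> y \<in> A \<Longrightarrow> x - y \<in> A"
    and m: "int m \<in> A" "m > 0"
  obtains d where "d dvd m" "A = {x. int d dvd x}"
proof -
  define d where "d = (LEAST d. d > 0 \<and> int d \<in> A)"
  have d: "d > 0" "int d \<in> A"
    using LeastI[of "\<lambda>d. d > 0 \<and> int d \<in> A" m] m by (auto simp: d_def)
  have least: "d \<le> e" if "e > 0" "int e \<in> A" for e
    using that by (auto simp: d_def intro: Least_le)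
  have zero: "0 \<in> A" using diff[OF m(1) m(1)] by simp
  have mult: "k * int d \<in> A" for k
  proof (induction k rule: int_induct[where k = 0])
    case base
    show ?case using zero by simp
  next
    case (step1 i)
    then have "i * int d - (0 - int d) \<in> A" using diff zero d by blast
    then show ?case by (simp add: algebra_simps)
  next
    case (step2 i)
    then have "i * int d - int d \<in> A" using diff d by blast
    then show ?case by (simp add: algebra_simps)
  qed
  have "int d dvd x" if "x \<in> A" for x
  proof (rule ccontr)
    assume "\<not> int d dvd x"
    then have "x mod int d \<noteq> 0" by (simp add: mod_eq_0_iff_dvd)
    moreover have "x mod int d \<ge> 0" using d by simp
    ultimately have pos: "x mod int d > 0" by linarith
    have "x mod int d \<in> A"
      using diff[OF that mult[of "x div int d"]] by (simp add: minus_div_mult_eq_mod)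
    then have "d \<le> nat (x mod int d)"
      using pos by (intro least) auto
    moreover have "x mod int d < int d" using d by simp
    ultimately show False using pos by linarith
  qed
  moreover have "x \<in> A" if "int d dvd x" for x
    using that mult by (metis dvdE mult.commute)
  ultimately have "A = {x. int d dvd x}" by blast
  moreover from this m have "d dvd m" by simp
  ultimately show thesis using that by blast
qed

text \<open>Subtracting \<open>m div d\<close> times \<open>(d, t)\<close> from
  \<open>(m, 0)\<close> leaves \<open>(0, - (m div d) * t)\<close>, so the last divisibility puts
  \<open>(m, 0)\<close> into the lattice; \<open>b dvd n\<close> does the same for
  \<open>(0, n)\<close>. The bound \<open>t < b\<close> makes the normal form unique.\<close>

definition hermite_params :: "nat \<Rightarrow> nat \<Rightarrow> (nat \<times> nat \<times> nat) set" where
  "hermite_params m n =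
     (SIGMA d:{d. d dvd m}. SIGMA b:{b. b dvd n}. {t. t < b \<and> b dvd (m div d) * t})"

text \<open>The lattice determines \<open>d\<close> through its first coordinates, \<open>b\<close>
  through its points on the second axis, and \<open>t\<close> modulo \<open>b\<close> through its
  points above \<open>d\<close>.\<close>

lemma inj_on_hermite_lattice:
  assumes "m > 0"
  shows "inj_on hermite_lattice (hermite_params m n)"
proof (rule inj_onI)
  fix p p'
  assume *: "p \<in> hermite_params m n" "p' \<in> hermite_params m n" "hermite_lattice p = hermite_lattice p'"
  obtain d b t d' b' t' where p: "p = (d, b, t)" "p' = (d', b', t')"
    by (metis prod.collapse)
  from * have params: "(d, b, t) \<in> hermite_params m n" "(d', b', t') \<in> hermite_params m n"
    and eq: "hermite_lattice (d, b, t) = hermite_lattice (d', b', t')"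
    by (simp_all add: p)
  have "{x. int d dvd x} = {x. int d' dvd x}"
    using eq fst_hermite_lattice by metis
  then have "int d dvd x \<longleftrightarrow> int d' dvd x" for x
    by (simp add: set_eq_iff)
  from this[of "int d"] this[of "int d'"] have d: "d' = d"
    by (simp add: dvd_antisym)
  have pos: "d > 0" using params assms by (auto simp: hermite_params_def intro: dvd_pos_nat)
  note mem = mem_hermite_lattice_iff[OF pos]
  have "int b dvd y \<longleftrightarrow> int b' dvd y" for y
    using mem[of 0 y b t] mem[of 0 y b' t'] eq d by simp
  from this[of "int b"] this[of "int b'"] have b: "b' = b"
    by (simp add: dvd_antisym)
  \<comment> \<open>The row \<open>(d, t)\<close> of the first lattice must belong to the
    second.\<close>
  have "int b dvd int t - int t'"
    using mem[of 1 "int t" b t] mem[of 1 "int t" b' t'] eq d b by simp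
  then have "int t mod int b = int t' mod int b"
    by (simp add: mod_eq_dvd_iff)
  then have "t = t'"
    using params b by (simp add: hermite_params_def)
  then show "p = p'" using d b p by simp
qed

lemma hermite_lattice_in_period_lattices:
  assumes "m > 0" "p \<in> hermite_params m n"
  shows "hermite_lattice p \<in> period_lattices m n"
proof -
  obtain d b t where p: "p = (d, b, t)" "d dvd m" "b dvd n" "b dvd (m div d) * t"
    using assms by (auto simp: hermite_params_def)
  have pos: "d > 0" using p assms by (auto intro: dvd_pos_nat)
  \<comment> \<open>This point is \<open>(int m, 0)\<close>, written in the form that the membership
    criterion expects.\<close>
  have "(int d * int (m div d), 0) \<in> hermite_lattice (d, b, t)"
    unfolding mem_hermite_lattice_iff[OF pos] using p
    by (metis diff_0 dvd_minus_iff int_dvd_int_iff mult.commute of_nat_mult)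
  moreover have "int d * int (m div d) = int m"
    using p by (simp flip: of_nat_mult)
  moreover have "(int d * 0, int n) \<in> hermite_lattice (d, b, t)"
    unfolding mem_hermite_lattice_iff[OF pos] using p by simp
  moreover have "u - v \<in> hermite_lattice (d, b, t)"
    if uv: "u \<in> hermite_lattice (d, b, t)" "v \<in> hermite_lattice (d, b, t)" for u v
  proof -
    obtain i j i' j' where "u = (int d * i, int t * i + int b * j)" "v = (int d * i', int t * i' + int b * j')"
      using uv by (auto simp: hermite_lattice_def)
    then have "u - v = (int d * (i - i'), int t * (i - i') + int b * (j - j'))"
      by (simp add: algebra_simps)
    then show ?thesis by (auto simp: hermite_lattice_def)
  qed
  ultimately show ?thesis
    by (simp add: p(1) period_lattices_def)
qed

text \<open>The projection of \<open>S\<close> to the first coordinate is generated by some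
  \<open>d\<close>, and its intersection with the second axis by some \<open>b\<close>. A point of
  \<open>S\<close> above \<open>d\<close>, reduced modulo \<open>b\<close>, supplies the row
  \<open>(d, t)\<close>.\<close>

lemma period_lattices_hermite_form:
  assumes "m > 0" "n > 0" and S: "S \<in> period_lattices m n"
  shows "S \<in> hermite_lattice ` hermite_params m n"
proof -
  have mS: "(int m, 0) \<in> S" and nS: "(0, int n) \<in> S"
    using S by (auto simp: period_lattices_def)
  obtain d where d: "d dvd m" "fst ` S = {x. int d dvd x}"
  proof (rule int_subgroup_eq_multiples)
    show "int m \<in> fst ` S" using mS by force
    show "x - y \<in> fst ` S" if "x \<in> fst ` S" "y \<in> fst ` S" for x y
      using that period_lattices_diff[OF S] by (force simp: image_iff)
  qed (use \<open>m > 0\<close> in auto)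
  obtain b where b: "b dvd n" "{y. (0, y) \<in> S} = {y. int b dvd y}"
  proof (rule int_subgroup_eq_multiples)
    show "int n \<in> {y. (0, y) \<in> S}" using nS by simp
    show "x - y \<in> {y. (0, y) \<in> S}" if "x \<in> {y. (0, y) \<in> S}" "y \<in> {y. (0, y) \<in> S}" for x y
      using that period_lattices_diff[OF S, of 0 x 0 y] by simp
  qed (use \<open>n > 0\<close> in auto)
  have pos: "d > 0" "b > 0"
    using d(1) b(1) assms by (auto intro: dvd_pos_nat)
  have zero_iff: "(0, y) \<in> S \<longleftrightarrow> int b dvd y" for y
    using b(2) by blast
  have "int d \<in> fst ` S" using d(2) by simp
  then obtain s where s: "(int d, s) \<in> S" by force
  define t where "t = nat (s mod int b)"
  have t: "t < b" "int t = s mod int b"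
    using pos by (auto simp: t_def nat_less_iff)
  have "(0, s - int t) \<in> S"
    by (simp add: zero_iff t(2) mod_eq_dvd_iff flip: minus_mod_eq_mult_div)
  from period_lattices_diff[OF S s this] have dt: "(int d, int t) \<in> S"
    by simp
  \<comment> \<open>Subtracting \<open>i\<close> times \<open>(d, t)\<close> moves the point to the
    second axis, where \<open>zero_iff\<close> decides. The criterion is the one for
    \<open>hermite_lattice (d, b, t)\<close>.\<close>
  have row_iff: "(int d * i, y) \<in> S \<longleftrightarrow> int b dvd y - int t * i" for i y
  proof -
    have *: "(int d * i, int t * i) \<in> S"
      using period_lattices_mult[OF S dt, of i] by (simp add: mult.commute)
    have "(int d * i, y) \<in> S \<longleftrightarrow> (0, y - int t * i) \<in> S"
      using period_lattices_diff[OF S _ *, of "int d * i" y]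
        period_lattices_add[OF S _ *, of 0 "y - int t * i"] by auto
    then show ?thesis by (simp add: zero_iff)
  qed
  have "int d * int (m div d) = int m"
    using d(1) by (simp flip: of_nat_mult)
  \<comment> \<open>The criterion applied to \<open>(int m, 0)\<close>.\<close>
  then have "int b dvd int t * int (m div d)"
    using mS row_iff[of "int (m div d)" 0] by simp
  then have "b dvd (m div d) * t"
    by (metis int_dvd_int_iff mult.commute of_nat_mult)
  then have "(d, b, t) \<in> hermite_params m n"
    using d(1) b(1) t(1) by (simp add: hermite_params_def)
  moreover have "S = hermite_lattice (d, b, t)"
  proof -
    have "(x, y) \<in> S \<longleftrightarrow> (x, y) \<in> hermite_lattice (d, b, t)" for x y
    proof (cases "int d dvd x")
      case True
      then obtain i where "x = int d * i" by auto
      then show ?thesis using row_iff mem_hermite_lattice_iff[OF pos(1)] by simp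
    next
      case False
      then have "x \<notin> fst ` S" "x \<notin> fst ` hermite_lattice (d, b, t)"
        using d(2) fst_hermite_lattice[of d b t] by auto
      then show ?thesis by force
    qed
    then show ?thesis by auto
  qed
  ultimately show ?thesis by blast
qed

lemma bij_betw_hermite_lattice:
  assumes "m > 0" "n > 0"
  shows "bij_betw hermite_lattice (hermite_params m n) (period_lattices m n)"
proof (rule bij_betw_imageI)
  show "inj_on hermite_lattice (hermite_params m n)"
    using assms by (intro inj_on_hermite_lattice)
  show "hermite_lattice ` hermite_params m n = period_lattices m n"
    using assms hermite_lattice_in_period_lattices period_lattices_hermite_form by blast
qed

section \<open>Counting the Hermite parameters\<close>

text \<open>Dividing \<open>a\<close> and \<open>b\<close> by their gcd \<open>g\<close> leaves
  coprime \<open>a'\<close> and \<open>b'\<close>, so the condition becomes \<open>b' dvd t\<close>;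
  below \<open>b = b' * g\<close> there are \<open>g\<close> such \<open>t\<close>.\<close>

lemma card_dvd_mult_eq_gcd:
  fixes a b :: nat
  assumes "b > 0"
  shows "card {t. t < b \<and> b dvd a * t} = gcd a b"
proof -
  define g where "g = gcd a b"
  have "gcd a b \<noteq> 0" using assms by simp
  from gcd_coprime_exists[OF this] obtain a' b' where ab: "a = a' * g" "b = b' * g" "coprime a' b'"
    unfolding g_def by blast
  have pos: "g > 0" "b' > 0" using ab assms by auto
  have "b dvd a * t \<longleftrightarrow> b' dvd t" for t
  proof -
    have "b dvd a * t \<longleftrightarrow> b' * g dvd (a' * t) * g"
      by (simp add: ab mult_ac)
    also have "\<dots> \<longleftrightarrow> b' dvd a' * t" using pos by simp
    also have "\<dots> \<longleftrightarrow> b' dvd t"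
      using ab(3) by (simp add: coprime_dvd_mult_right_iff coprime_commute)
    finally show ?thesis .
  qed
  then have "{t. t < b \<and> b dvd a * t} = (\<lambda>k. b' * k) ` {..<g}"
    using pos by (auto simp: ab(2) elim!: dvdE)
  moreover have "inj_on (\<lambda>k. b' * k) {..<g}"
    using pos by (auto intro: inj_onI)
  ultimately show ?thesis
    by (simp add: card_image g_def)
qed

lemma card_hermite_params:
  assumes "m > 0" "n > 0"
  shows "card (hermite_params m n) = (\<Sum>a | a dvd m. \<Sum>b | b dvd n. gcd a b)"
proof -
  have "card (hermite_params m n) = (\<Sum>d | d dvd m. \<Sum>b | b dvd n. card {t. t < b \<and> b dvd (m div d) * t})"
    using assms by (simp add: hermite_params_def)
  also have "\<dots> = (\<Sum>d | d dvd m. \<Sum>b | b dvd n. gcd (m div d) b)"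
    using assms by (intro sum.cong refl card_dvd_mult_eq_gcd) (auto intro: dvd_pos_nat)
  \<comment> \<open>Passing to the complementary divisor is an involution on the divisors of
    \<open>m\<close>.\<close>
  also have "\<dots> = (\<Sum>a | a dvd m. \<Sum>b | b dvd n. gcd a b)"
    by (rule sum.reindex_bij_witness[of _ "\<lambda>a. m div a" "\<lambda>a. m div a"]) (use assms in auto)
  finally show ?thesis .
qed

lemma card_subgroups_of_integer_mod_group_DirProd:
  assumes "m > 0" "n > 0"
  shows "card (subgroups_of (integer_mod_group m \<times>\<times> integer_mod_group n)) =
         (\<Sum>a | a dvd m. \<Sum>b | b dvd n. gcd a b)"
  using bij_betw_same_card[OF bij_betw_hermite_lattice[OF assms]]
    bij_betw_same_card[OF bij_betw_period_lattices_subgroups_of[OF assms]]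
    card_hermite_params[OF assms] by simp

theorem theorem3p1p1:
  fixes m n :: nat
  assumes "m > 0" and "n > 0"
  shows "cdeg (integer_mod_group m \<times>\<times> integer_mod_group n)
    = real (\<Sum>a | a dvd m. \<Sum>b | b dvd n. totient (gcd a b))
      / real (\<Sum>a | a dvd m. \<Sum>b | b dvd n. gcd a b)"
  using assms
  by (simp add: cdeg_def card_cyclic_subgroups_of_integer_mod_group_DirProd
      card_subgroups_of_integer_mod_group_DirProd)

end
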